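(* Let $n,k$ be positive integers and let $e_1\ge e_2\ge\dots\ge e_k$ be integers with $\sum_{i=1}^k e_i=\binom{n}{2}$. If $K_n$ has a Gallai $k$-coloring with exactly $e_i$ edges of color $i$ for each $1\le i\le k$, then $$\sum_{i=1}^{\ell} e_i\ge (n-1)+(n-2)+\dots+(n-\ell)$$ for every $1\le \ell\le k$.
   Context: A Gallai $k$-coloring of the complete graph $K_n$ is an assignment of one of the colors $1,\dots,k$ to each edge of $K_n$ (adjacent edges may have the same color) such that no triangle has its three edges colored with three pairwise different colors. *)

theory Defs
  imports "HOL-Library.Ramsey" "HOL-Library.FuncSet"
begin

(* Edges of the complete graph on V are the two-element subsets of V, i.e. nsets V 2. *)

definition rainbow_triangle :: "('a set \<Rightarrow> nat) \<Rightarrow> 'a \<Rightarrow> 'a \<Rightarrow> 'a \<Rightarrow> bool" where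
  "rainbow_triangle c x y z \<longleftrightarrow>
     c {x, y} \<noteq> c {y, z} \<and> c {y, z} \<noteq> c {x, z} \<and> c {x, y} \<noteq> c {x, z}"

definition gallai_coloring :: "'a set \<Rightarrow> nat \<Rightarrow> ('a set \<Rightarrow> nat) \<Rightarrow> bool" where
  "gallai_coloring V k c \<longleftrightarrow>
     c \<in> nsets V 2 \<rightarrow> {1..k} \<and>
     (\<forall>x\<in>V. \<forall>y\<in>V. \<forall>z\<in>V. x \<noteq> y \<and> y \<noteq> z \<and> x \<noteq> z \<longrightarrow> \<not> rainbow_triangle c x y z)"

end

theory Submission
  imports Defs
begin

text \<open>
  If some color in use does not connect the vertex set \<open>V\<close>, then one of its nontrivial components
  is seen in a single color by each vertex outside, and it can be contracted to a point. When
  every color in use connects \<open>V\<close>, at most two colors occur. Hence \<open>V\<close> splits into two parts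
  joined in one color, or into three parts joined in two colors, one of which connects \<open>V\<close>.
  By induction on such a split some \<open>l\<close> colors miss at most \<open>(card V - l) choose 2\<close> edges:
  one or two colors are spent between the parts, the others are distributed arbitrarily
  to the parts, and the numbers of missed edges add up by convexity of \<open>x choose 2\<close>.
\<close>

section \<open>Components of a single color and how outside vertices see them\<close>

definition rainbow_free :: "('a set \<Rightarrow> nat) \<Rightarrow> 'a set \<Rightarrow> bool" where
  "rainbow_free c V \<longleftrightarrow>
     (\<forall>x\<in>V. \<forall>y\<in>V. \<forall>z\<in>V. x \<noteq> y \<and> y \<noteq> z \<and> x \<noteq> z \<longrightarrow> \<not> rainbow_triangle c x y z)"

text \<open>Ordered pairs in both orientations, so the relation is symmetric and its reflexive
  transitive closure on \<open>V\<close> is connectivity in color \<open>a\<close>.\<close>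

definition color_edges :: "('a set \<Rightarrow> nat) \<Rightarrow> 'a set \<Rightarrow> nat \<Rightarrow> ('a \<times> 'a) set" where
  "color_edges c V a = {(u, v). u \<in> V \<and> v \<in> V \<and> u \<noteq> v \<and> c {u, v} = a}"

definition connected_color :: "('a set \<Rightarrow> nat) \<Rightarrow> 'a set \<Rightarrow> nat \<Rightarrow> bool" where
  "connected_color c V a \<longleftrightarrow> (\<forall>u\<in>V. \<forall>v\<in>V. (u, v) \<in> (color_edges c V a)\<^sup>*)"

definition component :: "('a set \<Rightarrow> nat) \<Rightarrow> 'a set \<Rightarrow> nat \<Rightarrow> 'a \<Rightarrow> 'a set" where
  "component c V a u = (color_edges c V a)\<^sup>* `` {u}"

lemma rainbow_free_subset: "rainbow_free c V \<Longrightarrow> W \<subseteq> V \<Longrightarrow> rainbow_free c W"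
  unfolding rainbow_free_def by blast

lemma rainbow_freeD:
  assumes "rainbow_free c V" "x \<in> V" "y \<in> V" "z \<in> V" "x \<noteq> y" "y \<noteq> z" "x \<noteq> z"
    and "c {x, y} \<noteq> c {x, z}" "c {x, y} \<noteq> c {y, z}"
  shows "c {x, z} = c {y, z}"
  using assms unfolding rainbow_free_def rainbow_triangle_def by metis

lemma component_refl: "u \<in> component c V a u"
  unfolding component_def by simp

lemma component_subset:
  assumes "u \<in> V"
  shows "component c V a u \<subseteq> V"
proof
  fix v assume "v \<in> component c V a u"
  then have "(u, v) \<in> (color_edges c V a)\<^sup>*" by (simp add: component_def)
  then show "v \<in> V" by induction (auto simp: color_edges_def assms)
qed

lemma component_step:
  assumes "v \<in> component c V a u" "v \<in> V" "w \<in> V" "v \<noteq> w" "c {v, w} = a"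
  shows "w \<in> component c V a u"
  using assms unfolding component_def color_edges_def
  by (auto intro: rtrancl_into_rtrancl)

lemma sym_color_edges: "sym (color_edges c V a)"
  unfolding color_edges_def sym_def by (auto simp: insert_commute)

lemma color_edges_rtrancl_sym:
  "(u, v) \<in> (color_edges c V a)\<^sup>* \<Longrightarrow> (v, u) \<in> (color_edges c V a)\<^sup>*"
  by (meson sym_color_edges sym_rtrancl symD)

lemma component_eq:
  assumes "v \<in> component c V a u"
  shows "component c V a v = component c V a u"
  using assms unfolding component_def
  by (auto intro: rtrancl_trans dest: color_edges_rtrancl_sym)

lemma connected_colorI:
  assumes "u \<in> V" "component c V a u = V"
  shows "connected_color c V a"
  unfolding connected_color_def
proof (intro ballI)
  fix v w assume "v \<in> V" "w \<in> V"
  then have "(u, v) \<in> (color_edges c V a)\<^sup>*" "(u, w) \<in> (color_edges c V a)\<^sup>*"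
    using assms(2) by (auto simp: component_def)
  then show "(v, w) \<in> (color_edges c V a)\<^sup>*"
    by (meson color_edges_rtrancl_sym rtrancl_trans)
qed

text \<open>A path in color \<open>a\<close> from a vertex of \<open>X\<close> to a vertex outside
  must leave \<open>X\<close> along some edge.\<close>

lemma connected_color_cut:
  assumes "connected_color c V a" "X \<subseteq> V" "X \<noteq> {}" "X \<noteq> V"
  obtains u v where "u \<in> X" "v \<in> V - X" "c {u, v} = a"
proof -
  obtain x y where xy: "x \<in> X" "y \<in> V - X" using assms by blast
  then have "(x, y) \<in> (color_edges c V a)\<^sup>*"
    using assms unfolding connected_color_def by blast
  then have "y \<notin> X \<longrightarrow> (\<exists>u v. u \<in> X \<and> v \<in> V - X \<and> c {u, v} = a)"
  proof induction
    case base
    then show ?case using xy by simp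
  next
    case (step y z)
    then show ?case unfolding color_edges_def by auto
  qed
  then show thesis using that xy by blast
qed

text \<open>No edge from the component to an outside \<open>z\<close> has color \<open>a\<close>,
  since otherwise \<open>z\<close> would belong to it. Hence for an \<open>a\<close>-edge inside the
  component the two edges to \<open>z\<close> must agree, and this equality travels along
  \<open>a\<close>-paths. It makes the component contractible.\<close>

lemma component_module:
  assumes gal: "rainbow_free c V" and "u \<in> V" "v \<in> component c V a u"
    and z: "z \<in> V" "z \<notin> component c V a u"
  shows "c {v, z} = c {u, z}" "c {v, z} \<noteq> a"
proof -
  have out: "c {w, z} \<noteq> a" if "w \<in> component c V a u" for w
    using component_step[OF that _ z(1)] component_subset[OF \<open>u \<in> V\<close>] that z
    by (metis subsetD)
  then show "c {v, z} \<noteq> a" using assms by blast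
  have "(u, v) \<in> (color_edges c V a)\<^sup>*" using assms by (simp add: component_def)
  then show "c {v, z} = c {u, z}"
  proof induction
    case base
    show ?case ..
  next
    case (step v w)
    then have vw: "v \<in> V" "w \<in> V" "v \<noteq> w" "c {v, w} = a"
      by (auto simp: color_edges_def)
    have mem: "v \<in> component c V a u" "w \<in> component c V a u"
      using step by (auto simp: component_def intro: rtrancl_into_rtrancl)
    have "c {v, z} = c {w, z}"
      using rainbow_freeD[OF gal vw(1,2) z(1) vw(3)] vw(4) out[OF mem(1)] out[OF mem(2)] mem z(2)
      by metis
    then show ?case using step.IH by simp
  qed
qed

section \<open>At most two colors can connect the vertex set\<close>

text \<open>After deleting \<open>x\<close>, every \<open>a\<close>-component still contains an \<open>a\<close>-neighbor of \<open>x\<close>. Triangles at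
  \<open>x\<close> then force the component of a \<open>b\<close>-neighbor of \<open>x\<close> to be joined to the other components in
  color \<open>b\<close>, and likewise for \<open>d\<close>.\<close>

lemma three_colors_step:
  assumes gal: "rainbow_free c V" and x: "x \<in> V"
    and dist: "a \<noteq> b" "a \<noteq> d" "b \<noteq> d"
    and con: "connected_color c V a"
    and y: "y \<in> V - {x}" "c {x, y} = b" and w: "w \<in> V - {x}" "c {x, w} = d"
    and nc: "\<not> connected_color c (V - {x}) a"
  shows False
proof -
  let ?W = "V - {x}"
  have galW: "rainbow_free c ?W" using rainbow_free_subset[OF gal] by blast
  have touch: "\<exists>m. m \<in> component c ?W a v \<and> c {x, m} = a" if v: "v \<in> ?W" for v
  proof -
    have sub: "component c ?W a v \<subseteq> ?W" using component_subset[OF v] .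
    have "component c ?W a v \<noteq> V" using x sub by blast
    then obtain p q where pq: "p \<in> component c ?W a v" "q \<in> V - component c ?W a v" "c {p, q} = a"
      using connected_color_cut[OF con, of "component c ?W a v"] sub component_refl by (metis Diff_subset empty_iff subset_trans)
    have "q = x"
    proof (rule ccontr)
      assume "q \<noteq> x"
      then have "q \<in> component c ?W a v"
        using component_step[OF pq(1)] pq sub by (metis DiffD1 DiffD2 DiffI singletonD subsetD)
      then show False using pq by blast
    qed
    then show ?thesis using pq by (auto simp: insert_commute)
  qed
  have col: "c {v, m} = g"
    if "v \<in> ?W" "c {x, v} = g" "g \<noteq> a" "m \<in> ?W" "m \<notin> component c ?W a v" "c {x, m} = a" for v m g
  proof -
    have ne: "c {v, m} \<noteq> a"
      using component_module(2)[OF galW that(1) component_refl that(4,5)] .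
    have "v \<noteq> m" using that component_refl by metis
    then show ?thesis
      using rainbow_freeD[OF gal x, of m v] that ne by (auto simp: insert_commute)
  qed
  show False
  proof (cases "w \<in> component c ?W a y")
    case True
    \<comment> \<open>The common component of \<open>y\<close> and \<open>w\<close> is not
      everything. An \<open>a\<close>-neighbor \<open>z\<close> of \<open>x\<close> in another
      component is joined to \<open>y\<close> in color \<open>b\<close> and to \<open>w\<close> in
      color \<open>d\<close>, but it must see this component in one color.\<close>
    obtain t where t: "t \<in> ?W" "t \<notin> component c ?W a y"
      using nc connected_colorI[OF y(1)] component_subset[OF y(1)] by blast
    obtain z where z: "z \<in> component c ?W a t" "c {x, z} = a" using touch[OF t(1)] by blast
    have zW: "z \<in> ?W" using z component_subset[OF t(1)] by blast
    have zy: "z \<notin> component c ?W a y"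
      using component_eq[OF z(1)] component_eq[of z c ?W a y] t(2) component_refl by metis
    have "c {y, z} = b" using col[OF y _ zW zy z(2)] dist by blast
    moreover have "c {w, z} = d"
      using col[OF w _ zW _ z(2)] dist component_eq[OF True] zy by metis
    ultimately show False using component_module(1)[OF galW y(1) True zW zy] dist by metis
  next
    case False
    \<comment> \<open>Two different components see each other in one color. It is \<open>b\<close>
      by the edge from \<open>y\<close> to \<open>z\<close>, and \<open>d\<close> by the edge from
      \<open>w\<close> to \<open>m\<close>; both are transported to the edge between
      \<open>y\<close> and \<open>w\<close>.\<close>
    obtain z where z: "z \<in> component c ?W a w" "c {x, z} = a" using touch[OF w(1)] by blast
    have zW: "z \<in> ?W" using z component_subset[OF w(1)] by blast
    have zy: "z \<notin> component c ?W a y"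
      using component_eq[OF z(1)] component_eq[of z c ?W a y] False component_refl by metis
    have yw: "y \<notin> component c ?W a w"
      using component_eq[of y c ?W a w] False component_refl by metis
    have 1: "c {y, z} = b" using col[OF y _ zW zy z(2)] dist by blast
    obtain m where m: "m \<in> component c ?W a y" "c {x, m} = a" using touch[OF y(1)] by blast
    have mW: "m \<in> ?W" using m component_subset[OF y(1)] by blast
    have mw: "m \<notin> component c ?W a w"
      using component_eq[OF m(1)] component_eq[of m c ?W a w] False component_refl by metis
    have "c {w, m} = d" using col[OF w _ mW mw m(2)] dist by blast
    then have 2: "c {y, w} = d"
      using component_module(1)[OF galW y(1) m(1) w(1) False] by (simp add: insert_commute)
    have "c {z, y} = c {w, y}" using component_module(1)[OF galW w(1) z(1) y(1) yw] .
    then show False using 1 2 dist by (simp add: insert_commute)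
  qed
qed

lemma connected_color_incident:
  assumes "connected_color c V a" "x \<in> V" "V \<noteq> {x}"
  obtains y where "y \<in> V - {x}" "c {x, y} = a"
  using connected_color_cut[OF assms(1), of "{x}"] assms by auto

text \<open>Deleting a vertex \<open>x\<close> from a counterexample would leave a smaller one
  unless some color stops being connected, and \<open>three_colors_step\<close> excludes that for
  each of the three colors in turn.\<close>

lemma no_three_connected_colors:
  assumes "finite V" "rainbow_free c V" "card V \<ge> 2" "a \<noteq> b" "a \<noteq> d" "b \<noteq> d"
    and "connected_color c V a" "connected_color c V b" "connected_color c V d"
  shows False
  using assms
proof (induction "card V" arbitrary: V)
  case 0
  then show ?case by simp
next
  case (Suc n)
  obtain x where x: "x \<in> V" using Suc.prems(3) by fastforce
  have ne: "V \<noteq> {x}" using Suc.prems(3) by auto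
  obtain p where p: "p \<in> V - {x}" "c {x, p} = a"
    using connected_color_incident[OF Suc.prems(7) x ne] .
  obtain q where q: "q \<in> V - {x}" "c {x, q} = b"
    using connected_color_incident[OF Suc.prems(8) x ne] .
  obtain r where r: "r \<in> V - {x}" "c {x, r} = d"
    using connected_color_incident[OF Suc.prems(9) x ne] .
  have card: "card (V - {x}) = n" using Suc x by simp
  \<comment> \<open>Neighbors of \<open>x\<close> in different colors are different vertices, so the
    size bound survives the deletion; this also disposes of two-element sets.\<close>
  have "card {p, q} = 2" using p q Suc.prems(4) by (auto simp: card_insert_if)
  then have n2: "card (V - {x}) \<ge> 2"
    using card_mono[of "V - {x}" "{p, q}"] p q Suc.prems(1) by simp
  have gal: "rainbow_free c (V - {x})" using rainbow_free_subset[OF Suc.prems(2)] by blast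
  consider "\<not> connected_color c (V - {x}) a" | "\<not> connected_color c (V - {x}) b"
    | "\<not> connected_color c (V - {x}) d"
    using Suc.hyps(1)[OF card[symmetric] _ gal n2 Suc.prems(4-6)] Suc.prems(1) by blast
  then show ?case
  proof cases
    case 1
    show ?thesis
      using three_colors_step[OF Suc.prems(2) x _ _ _ Suc.prems(7) q r 1] Suc.prems(4-6) by blast
  next
    case 2
    show ?thesis
      using three_colors_step[OF Suc.prems(2) x _ _ _ Suc.prems(8) p r 2] Suc.prems(4-6) by blast
  next
    case 3
    show ?thesis
      using three_colors_step[OF Suc.prems(2) x _ _ _ Suc.prems(9) p q 3] Suc.prems(4-6) by blast
  qed
qed

section \<open>Splitting the vertex set into parts joined in few colors\<close>

definition one_color_split :: "('a set \<Rightarrow> nat) \<Rightarrow> 'a set \<Rightarrow> bool" where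
  "one_color_split c V \<longleftrightarrow> (\<exists>a A B. V = A \<union> B \<and> A \<inter> B = {} \<and> A \<noteq> {} \<and> B \<noteq> {} \<and>
     (\<forall>x\<in>A. \<forall>y\<in>B. c {x, y} = a))"

text \<open>Connectedness of \<open>a\<close> serves the case where only one color may be chosen, which cannot
  cover all edges between the parts.\<close>

definition two_color_split :: "('a set \<Rightarrow> nat) \<Rightarrow> 'a set \<Rightarrow> bool" where
  "two_color_split c V \<longleftrightarrow> (\<exists>a b A B C. connected_color c V a \<and>
     V = A \<union> B \<union> C \<and> A \<inter> B = {} \<and> A \<inter> C = {} \<and> B \<inter> C = {} \<and> A \<noteq> {} \<and> B \<noteq> {} \<and> C \<noteq> {} \<and>
     (\<forall>x\<in>A. \<forall>y\<in>B. c {x, y} \<in> {a, b}) \<and> (\<forall>x\<in>A. \<forall>y\<in>C. c {x, y} \<in> {a, b}) \<and>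
     (\<forall>x\<in>B. \<forall>y\<in>C. c {x, y} \<in> {a, b}))"

text \<open>Undoes the contraction of \<open>M\<close> to \<open>u\<close>: the parts are pulled
  back to preimages, and edges between different preimages keep the colors of their images.\<close>

lemma split_lift:
  assumes u: "u \<in> V" and "M \<subseteq> V" "u \<in> M" "M \<noteq> V"
    and mod: "\<And>v z. v \<in> M \<Longrightarrow> z \<in> V - M \<Longrightarrow> c {v, z} = c {u, z}"
    and split: "one_color_split c (V - M \<union> {u}) \<or> two_color_split c (V - M \<union> {u})"
  shows "one_color_split c V \<or> two_color_split c V"
proof -
  let ?T = "V - M \<union> {u}"
  \<comment> \<open>\<open>f\<close> is the contraction map and \<open>F\<close> takes preimages
    under it. Edges inside \<open>M\<close> never run between two disjoint preimages, because
    \<open>f\<close> sends both ends to \<open>u\<close>.\<close>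
  define f where "f v = (if v \<in> M then u else v)" for v
  define F where "F A = {v \<in> V. f v \<in> A}" for A
  have cf: "c {x, y} = c {f x, f y}" if "x \<in> V" "y \<in> V" "f x \<noteq> f y" for x y
    using that mod[of x y] mod[of y x] unfolding f_def by (auto split: if_splits simp: insert_commute)
  have fT: "f v \<in> ?T" if "v \<in> V" for v using that by (auto simp: f_def)
  have fid: "f v = v" if "v \<in> ?T" for v using that by (auto simp: f_def)
  have TV: "?T \<subseteq> V" using u by blast
  have Fne: "F A \<noteq> {}" if "A \<noteq> {}" "A \<subseteq> ?T" for A
  proof -
    have "A \<subseteq> F A" using that(2) fid TV unfolding F_def by (auto simp: subset_iff)
    then show ?thesis using that(1) by blast
  qed
  have Fdis: "F A \<inter> F B = {}" if "A \<inter> B = {}" for A B using that by (auto simp: F_def)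
  have Fcol: "\<forall>x\<in>F A. \<forall>y\<in>F B. c {x, y} \<in> S"
    if "A \<inter> B = {}" "\<forall>x\<in>A. \<forall>y\<in>B. c {x, y} \<in> S" for A B S
    using that cf unfolding F_def by (metis (mono_tags, lifting) disjoint_iff mem_Collect_eq)
  from split show ?thesis
  proof
    assume "one_color_split c ?T"
    then obtain a A B where *: "?T = A \<union> B" "A \<inter> B = {}" "A \<noteq> {}" "B \<noteq> {}"
      "\<forall>x\<in>A. \<forall>y\<in>B. c {x, y} \<in> {a}" unfolding one_color_split_def by auto
    have "V = F A \<union> F B" using fT *(1) unfolding F_def by auto
    moreover have "\<forall>x\<in>F A. \<forall>y\<in>F B. c {x, y} = a" using Fcol[OF *(2,5)] by simp
    ultimately have "one_color_split c V"
      unfolding one_color_split_def using Fdis[OF *(2)] Fne[OF *(3)] Fne[OF *(4)] *(1) by blast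
    then show ?thesis ..
  next
    assume "two_color_split c ?T"
    then obtain a b A B C where *: "?T = A \<union> B \<union> C" "A \<inter> B = {}" "A \<inter> C = {}" "B \<inter> C = {}"
      "A \<noteq> {}" "B \<noteq> {}" "C \<noteq> {}"
      "\<forall>x\<in>A. \<forall>y\<in>B. c {x, y} \<in> {a, b}" "\<forall>x\<in>A. \<forall>y\<in>C. c {x, y} \<in> {a, b}"
      "\<forall>x\<in>B. \<forall>y\<in>C. c {x, y} \<in> {a, b}" and con: "connected_color c ?T a"
      unfolding two_color_split_def by (elim exE conjE) (rule that; assumption)
    have V: "V = F A \<union> F B \<union> F C" using fT *(1) unfolding F_def by auto
    have ne: "F A \<noteq> {}" "F B \<noteq> {}" "F C \<noteq> {}"
      using Fne *(1,5,6,7) by (metis Un_upper1 Un_upper2 le_supI1)+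
    have "connected_color c V a"
    proof (rule connected_colorI[OF u])
      have T: "?T \<subseteq> component c V a u"
      proof
        fix t assume "t \<in> ?T"
        then have "(u, t) \<in> (color_edges c ?T a)\<^sup>*" using con unfolding connected_color_def by blast
        moreover have "color_edges c ?T a \<subseteq> color_edges c V a"
          using TV unfolding color_edges_def by blast
        ultimately show "t \<in> component c V a u"
          unfolding component_def using rtrancl_mono by blast
      qed
      \<comment> \<open>The vertex \<open>z\<close> makes the contracted set larger than
        \<open>{u}\<close>, so \<open>u\<close> has an \<open>a\<close>-neighbor \<open>t\<close>
        there. As \<open>t\<close> lies outside \<open>M\<close>, all of \<open>M\<close> is joined
        to \<open>t\<close> in color \<open>a\<close>, which attaches \<open>M\<close> to the
        component of \<open>u\<close>.\<close>
      obtain z where "z \<in> V - M" using \<open>M \<noteq> V\<close> \<open>M \<subseteq> V\<close> by blast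
      then have "z \<in> ?T" "z \<noteq> u" using \<open>u \<in> M\<close> by auto
      then have "?T \<noteq> {u}" by blast
      then obtain t where t: "t \<in> ?T - {u}" "c {u, t} = a"
        by (rule connected_color_incident[OF con UnI2[OF singletonI]])
      have "v \<in> component c V a u" if "v \<in> M" for v
      proof -
        have "t \<in> V - M" using t(1) \<open>u \<in> M\<close> by blast
        then have "c {t, v} = a" "t \<in> V" "t \<noteq> v"
          using mod[OF that] t(2) that by (auto simp: insert_commute)
        moreover have "t \<in> component c V a u" by (rule subsetD[OF T DiffD1[OF t(1)]])
        moreover have "v \<in> V" by (rule subsetD[OF \<open>M \<subseteq> V\<close> that])
        ultimately show ?thesis using component_step by metis
      qed
      then have "V \<subseteq> component c V a u" using T by auto
      then show "component c V a u = V" using component_subset[OF u] by (rule equalityI[rotated])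
    qed
    then have "two_color_split c V"
      unfolding two_color_split_def
      using V Fdis[OF *(2)] Fdis[OF *(3)] Fdis[OF *(4)] Fcol[OF *(2,8)] Fcol[OF *(3,9)] Fcol[OF *(4,10)]
        ne by (intro exI[of _ a] exI[of _ b] exI[of _ "F A"] exI[of _ "F B"] exI[of _ "F C"] conjI) assumption+
    then show ?thesis ..
  qed
qed

lemma gallai_split:
  assumes "finite V" "rainbow_free c V" "card V \<ge> 2"
  shows "one_color_split c V \<or> two_color_split c V"
  using assms
proof (induction "card V" arbitrary: V rule: less_induct)
  case less
  obtain x y where xy: "x \<in> V" "y \<in> V" "x \<noteq> y"
    using less.prems(3) card_le_Suc0_iff_eq[OF less.prems(1)] by auto
  show ?case
  proof (cases "\<exists>p\<in>V. \<exists>q\<in>V. p \<noteq> q \<and> \<not> connected_color c V (c {p, q})")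
    case True
    then obtain p q where pq: "p \<in> V" "q \<in> V" "p \<noteq> q" "\<not> connected_color c V (c {p, q})" by blast
    define M where "M = component c V (c {p, q}) p"
    have M: "M \<subseteq> V" "p \<in> M"
      unfolding M_def by (rule component_subset[OF pq(1)], rule component_refl)
    have "M \<noteq> V" using connected_colorI[OF pq(1)] pq(4) unfolding M_def by metis
    \<comment> \<open>A second vertex of \<open>M\<close> makes the contraction strictly smaller
      than \<open>V\<close>, as the induction requires.\<close>
    have "q \<in> M"
      unfolding M_def by (rule component_step[OF component_refl pq(1,2,3) refl])
    let ?T = "V - M \<union> {p}"
    have TV: "?T \<subseteq> V" using pq by blast
    have "q \<notin> ?T" using \<open>q \<in> M\<close> pq(3) by simp
    then have "?T \<subset> V" using TV pq(2) by (metis psubsetI)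
    then have lt: "card ?T < card V" using less.prems(1) by (simp add: psubset_card_mono)
    obtain z where z: "z \<in> V - M" using M(1) \<open>M \<noteq> V\<close> by (metis Diff_eq_empty_iff equals0I subset_antisym)
    have "z \<noteq> p" using z M(2) by auto
    then have "card {z, p} = 2" by simp
    then have "card ?T \<ge> 2"
      using card_mono[of ?T "{z, p}"] less.prems(1) z by auto
    then have "one_color_split c ?T \<or> two_color_split c ?T"
      using less.hyps[OF lt] finite_subset[OF TV less.prems(1)] rainbow_free_subset[OF less.prems(2) TV] by blast
    moreover have "c {v, z} = c {p, z}" if "v \<in> M" "z \<in> V - M" for v z
      using component_module(1)[OF less.prems(2) pq(1)] that unfolding M_def by blast
    ultimately show ?thesis
      using split_lift[OF pq(1) M \<open>M \<noteq> V\<close>] by metis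
  next
    case False
    then have con: "connected_color c V (c {p, q})" if "p \<in> V" "q \<in> V" "p \<noteq> q" for p q
      using that by blast
    define a where "a = c {x, y}"
    show ?thesis
    proof (cases "\<forall>p\<in>V. \<forall>q\<in>V. p \<noteq> q \<longrightarrow> c {p, q} = a")
      case True
      have "one_color_split c V" unfolding one_color_split_def
        by (intro exI[of _ a] exI[of _ "{x}"] exI[of _ "V - {x}"]) (use xy True in auto)
      then show ?thesis ..
    next
      case False
      then obtain p q where pq: "p \<in> V" "q \<in> V" "p \<noteq> q" "c {p, q} \<noteq> a" by blast
      define b where "b = c {p, q}"
      have two: "c {v, w} \<in> {a, b}" if "v \<in> V" "w \<in> V" "v \<noteq> w" for v w
      proof (rule ccontr)
        assume "c {v, w} \<notin> {a, b}"
        then show False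
          using no_three_connected_colors[OF less.prems, of a b "c {v, w}"] con xy pq that
          unfolding a_def b_def by auto
      qed
      \<comment> \<open>Edges \<open>{x, y}\<close> and \<open>{p, q}\<close> differ in color, so
        they are different edges and a third vertex exists. With only two colors around, any three
        nonempty parts will do.\<close>
      obtain z where z: "z \<in> V" "z \<noteq> x" "z \<noteq> y"
        using pq unfolding a_def by (metis doubleton_eq_iff)
      have "connected_color c V a" using con xy unfolding a_def by blast
      then have "two_color_split c V" unfolding two_color_split_def
        by (intro exI[of _ a] exI[of _ b] exI[of _ "{x}"] exI[of _ "{y}"] exI[of _ "V - {x, y}"])
          (use xy z two in auto)
      then show ?thesis ..
    qed
  qed
qed

section \<open>Counting the edges missed by a set of colors\<close>

definition uncovered :: "('a set \<Rightarrow> nat) \<Rightarrow> 'a set \<Rightarrow> nat set \<Rightarrow> 'a set set" where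
  "uncovered c V S = {E \<in> nsets V 2. c E \<notin> S}"

lemma finite_uncovered: "finite V \<Longrightarrow> finite (uncovered c V S)"
  unfolding uncovered_def by (simp add: finite_imp_finite_nsets)

lemma card_uncovered_antimono:
  assumes "finite V" "S \<subseteq> S'"
  shows "card (uncovered c V S') \<le> card (uncovered c V S)"
  by (rule card_mono[OF finite_uncovered[OF assms(1)]]) (use assms(2) in \<open>auto simp: uncovered_def\<close>)

lemma card_uncovered_Un:
  assumes "finite A" "finite B" and cross: "\<forall>x\<in>A. \<forall>y\<in>B. c {x, y} \<in> S"
  shows "card (uncovered c (A \<union> B) S) \<le> card (uncovered c A S) + card (uncovered c B S)"
proof -
  have "uncovered c (A \<union> B) S \<subseteq> uncovered c A S \<union> uncovered c B S"
  proof
    fix E assume "E \<in> uncovered c (A \<union> B) S"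
    then obtain x y where E: "E = {x, y}" "x \<in> A \<union> B" "y \<in> A \<union> B" "x \<noteq> y" "c {x, y} \<notin> S"
      unfolding uncovered_def nsets_def by (auto simp: card_2_iff)
    then have "(x \<in> A \<and> y \<in> A) \<or> (x \<in> B \<and> y \<in> B)"
      using cross by (metis UnE insert_commute)
    then show "E \<in> uncovered c A S \<union> uncovered c B S"
      using E unfolding uncovered_def nsets_def by auto
  qed
  then have "card (uncovered c (A \<union> B) S) \<le> card (uncovered c A S \<union> uncovered c B S)"
    using assms(1,2) by (intro card_mono) (auto simp: finite_uncovered)
  also have "\<dots> \<le> card (uncovered c A S) + card (uncovered c B S)" by (rule card_Un_le)
  finally show ?thesis .
qed

text \<open>A tree in color \<open>a\<close> is grown one vertex at a time: each cut edge leaving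
  \<open>X\<close> adds one vertex and one new edge.\<close>

lemma connected_color_card:
  assumes fin: "finite V" and con: "connected_color c V a" and "m \<le> card V" "m \<ge> 1"
  shows "\<exists>X\<subseteq>V. card X = m \<and> m - 1 \<le> card {E \<in> nsets X 2. c E = a}"
  using assms(4,3)
proof (induction m rule: dec_induct)
  case base
  then obtain v where "v \<in> V" by fastforce
  then show ?case by (intro exI[of _ "{v}"]) simp
next
  case (step m)
  then obtain X where X: "X \<subseteq> V" "card X = m" "m - 1 \<le> card {E \<in> nsets X 2. c E = a}" by auto
  have finX: "finite X" using X fin finite_subset by blast
  have "X \<noteq> {}" "X \<noteq> V" using X step by auto
  then obtain u v where uv: "u \<in> X" "v \<in> V - X" "c {u, v} = a"
    using connected_color_cut[OF con X(1)] by blast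
  let ?N = "\<lambda>X. {E \<in> nsets X 2. c E = a}"
  have "insert {u, v} (?N X) \<subseteq> ?N (insert v X)"
    using uv by (auto simp: nsets_def card_insert_if)
  then have "card (insert {u, v} (?N X)) \<le> card (?N (insert v X))"
    using finX by (intro card_mono) (auto simp: finite_imp_finite_nsets)
  moreover have "{u, v} \<notin> ?N X" using uv by (auto simp: nsets_def)
  then have "card (insert {u, v} (?N X)) = Suc (card (?N X))"
    using finX by (simp add: finite_imp_finite_nsets)
  ultimately show ?case
    using X uv finX by (intro exI[of _ "insert v X"]) auto
qed

text \<open>Two complete graphs on \<open>x\<close> and \<open>y\<close> vertices that share a
  single vertex fit into one on \<open>x + y - 1\<close> vertices.\<close>

lemma choose_two_add_le:
  assumes "x \<ge> 1" "y \<ge> 1"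
  shows "(x choose 2) + (y choose 2) \<le> (x + y - 1) choose 2"
proof -
  obtain i j where ij: "x = Suc i" "y = Suc j" using assms by (metis Suc_le_D One_nat_def)
  have "(Suc i choose 2) + (Suc j choose 2) \<le> Suc (i + j) choose 2" for j
    by (induction j) (auto simp: numeral_2_eq_2)
  then show ?thesis using ij by simp
qed

text \<open>The tree for \<open>m = card V\<close> spans \<open>V\<close>, and removing its
  \<open>card V - 1\<close> edges from the total leaves the next smaller binomial
  coefficient.\<close>

lemma card_uncovered_connected_color:
  assumes "finite V" "connected_color c V a" "card V \<ge> 1"
  shows "card (uncovered c V {a}) \<le> (card V - 1) choose 2"
proof -
  let ?N = "{E \<in> nsets V 2. c E = a}"
  have "card V - 1 \<le> card ?N"
    using connected_color_card[OF assms(1,2) order_refl assms(3)] assms(1)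
    by (metis card_subset_eq)
  moreover have "card (uncovered c V {a}) + card ?N = card V choose 2"
  proof -
    have "card (uncovered c V {a} \<union> ?N) = card (uncovered c V {a}) + card ?N"
      by (rule card_Un_disjoint) (auto simp: uncovered_def finite_imp_finite_nsets assms)
    moreover have "uncovered c V {a} \<union> ?N = nsets V 2" by (auto simp: uncovered_def)
    ultimately show ?thesis by simp
  qed
  moreover have "card V choose 2 = (card V - 1) + ((card V - 1) choose 2)"
    using assms(3) by (cases "card V") (auto simp: numeral_2_eq_2)
  ultimately show ?thesis by linarith
qed

text \<open>Each time the bounds of two parts are merged, \<open>choose_two_add_le\<close> lowers
  the vertex count by one. This pays for one color spent between two parts, and for two colors spent
  among three parts.\<close>

lemma gallai_few_uncovered:
  assumes "finite V" "rainbow_free c V" "l < card V"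
  shows "\<exists>S. finite S \<and> card S \<le> l \<and> card (uncovered c V S) \<le> (card V - l) choose 2"
  using assms
proof (induction "card V" arbitrary: V l rule: less_induct)
  case less
  have IH: "\<exists>S. finite S \<and> card S \<le> p \<and> card (uncovered c A S) \<le> (card A - p) choose 2"
    if "A \<subset> V" "p < card A" for A p
    using less.hyps[of A p] less.prems that psubset_card_mono[OF less.prems(1) that(1)]
      finite_subset[of A V] rainbow_free_subset[of c V A] by blast
  show ?case
  proof (cases "l = 0")
    case True
    then show ?thesis by (intro exI[of _ "{}"]) (simp add: uncovered_def)
  next
    case False
    then have "card V \<ge> 2" using less.prems(3) by simp
    from gallai_split[OF less.prems(1,2) this] show ?thesis
    proof
      assume "one_color_split c V"
      then obtain a A B where AB: "V = A \<union> B" "A \<inter> B = {}" "A \<noteq> {}" "B \<noteq> {}"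
        "\<forall>x\<in>A. \<forall>y\<in>B. c {x, y} = a" unfolding one_color_split_def by blast
      have fin: "finite A" "finite B" using less.prems(1) AB(1) by auto
      have cV: "card V = card A + card B" using card_Un_disjoint[OF fin AB(2)] AB(1) by simp
      have pos: "card A \<ge> 1" "card B \<ge> 1" using fin AB by (simp_all add: Suc_leI card_gt_0_iff)
      \<comment> \<open>The \<open>l - 1\<close> remaining colors fill \<open>A\<close> first, up to
        \<open>card A - 1\<close>. The rest stays below \<open>card B\<close>, because
        \<open>l < card V\<close> gives
        \<open>l - 1 \<le> (card A - 1) + (card B - 1)\<close>.\<close>
      define p where "p = min (l - 1) (card A - 1)"
      define q where "q = l - 1 - p"
      have pq: "p < card A" "q < card B" "p + q = l - 1"
        using pos cV less.prems(3) False unfolding p_def q_def by auto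
      obtain S where S: "finite S" "card S \<le> p" "card (uncovered c A S) \<le> (card A - p) choose 2"
        using IH[OF _ pq(1)] AB by blast
      obtain T where T: "finite T" "card T \<le> q" "card (uncovered c B T) \<le> (card B - q) choose 2"
        using IH[OF _ pq(2)] AB by blast
      let ?S = "insert a (S \<union> T)"
      have "card ?S \<le> l"
        using card_insert_le_m1[of l "S \<union> T" a] card_Un_le[of S T] S(2) T(2) pq(3) False by linarith
      moreover have "card (uncovered c V ?S) \<le> (card V - l) choose 2"
      proof -
        have "card (uncovered c V ?S) \<le> card (uncovered c A ?S) + card (uncovered c B ?S)"
          unfolding AB(1) using AB(5) by (intro card_uncovered_Un[OF fin]) simp
        also have "\<dots> \<le> card (uncovered c A S) + card (uncovered c B T)"
          by (intro add_mono card_uncovered_antimono fin) auto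
        also have "\<dots> \<le> ((card A - p) choose 2) + ((card B - q) choose 2)"
          using S(3) T(3) by simp
        also have "\<dots> \<le> (card A - p + (card B - q) - 1) choose 2"
          using pq by (intro choose_two_add_le) auto
        also have "card A - p + (card B - q) - 1 = card V - l"
          using pq cV False by linarith
        finally show ?thesis .
      qed
      moreover have "finite ?S" using S(1) T(1) by simp
      ultimately show ?thesis by (intro exI[of _ ?S] conjI)
    next
      assume "two_color_split c V"
      then obtain a b A B C where con: "connected_color c V a" and
        V: "V = A \<union> B \<union> C" and dis: "A \<inter> B = {}" "A \<inter> C = {}" "B \<inter> C = {}" and
        ne: "A \<noteq> {}" "B \<noteq> {}" "C \<noteq> {}" and
        col: "\<forall>x\<in>A. \<forall>y\<in>B. c {x, y} \<in> {a, b}" "\<forall>x\<in>A. \<forall>y\<in>C. c {x, y} \<in> {a, b}"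
          "\<forall>x\<in>B. \<forall>y\<in>C. c {x, y} \<in> {a, b}"
        unfolding two_color_split_def by (elim exE conjE) (rule that; assumption)
      show ?thesis
      proof (cases "l = 1")
        case True
        then show ?thesis
          using card_uncovered_connected_color[OF less.prems(1) con] \<open>card V \<ge> 2\<close>
          by (intro exI[of _ "{a}"]) auto
      next
        case False
        with \<open>l \<noteq> 0\<close> have l2: "l \<ge> 2" by simp
        have fin: "finite A" "finite B" "finite C" using less.prems(1) V by auto
        have cV: "card V = card A + card B + card C"
          using card_Un_disjoint[OF fin(1,2) dis(1)] card_Un_disjoint[of "A \<union> B" C] fin dis V
          by (simp add: Int_Un_distrib2)
        have pos: "card A \<ge> 1" "card B \<ge> 1" "card C \<ge> 1"
          using fin ne by (simp_all add: Suc_leI card_gt_0_iff)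
        \<comment> \<open>The same greedy distribution of \<open>l - 2\<close> colors, which fits
          because \<open>l - 2 \<le> (card A - 1) + (card B - 1) + (card C - 1)\<close>.\<close>
        define p where "p = min (l - 2) (card A - 1)"
        define q where "q = min (l - 2 - p) (card B - 1)"
        define r where "r = l - 2 - p - q"
        have pqr: "p < card A" "q < card B" "r < card C" "p + q + r = l - 2"
          using pos cV less.prems(3) l2 unfolding p_def q_def r_def by linarith+
        have sub: "A \<subset> V" "B \<subset> V" "C \<subset> V" using V dis ne by blast+
        obtain S where S: "finite S" "card S \<le> p" "card (uncovered c A S) \<le> (card A - p) choose 2"
          using IH[OF sub(1) pqr(1)] by blast
        obtain T where T: "finite T" "card T \<le> q" "card (uncovered c B T) \<le> (card B - q) choose 2"
          using IH[OF sub(2) pqr(2)] by blast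
        obtain U where U: "finite U" "card U \<le> r" "card (uncovered c C U) \<le> (card C - r) choose 2"
          using IH[OF sub(3) pqr(3)] by blast
        let ?S = "{a, b} \<union> (S \<union> T \<union> U)"
        have "card {a, b} \<le> 2" by (simp add: card_insert_if)
        then have "card ?S \<le> l"
          using card_Un_le[of "{a, b}" "S \<union> T \<union> U"] card_Un_le[of "S \<union> T" U] card_Un_le[of S T]
            S(2) T(2) U(2) pqr(4) l2 by linarith
        moreover have "card (uncovered c V ?S) \<le> (card V - l) choose 2"
        proof -
          have "card (uncovered c V ?S) \<le> card (uncovered c (A \<union> B) ?S) + card (uncovered c C ?S)"
            unfolding V using col fin by (intro card_uncovered_Un) auto
          also have "\<dots> \<le> card (uncovered c A ?S) + card (uncovered c B ?S) + card (uncovered c C ?S)"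
            using col fin by (intro add_mono card_uncovered_Un) auto
          also have "\<dots> \<le> card (uncovered c A S) + card (uncovered c B T) + card (uncovered c C U)"
            by (intro add_mono card_uncovered_antimono fin) auto
          also have "\<dots> \<le> ((card A - p) choose 2) + ((card B - q) choose 2) + ((card C - r) choose 2)"
            using S(3) T(3) U(3) by simp
          also have "\<dots> \<le> ((card A - p + (card B - q) - 1) choose 2) + ((card C - r) choose 2)"
            using pqr by (intro add_mono choose_two_add_le) auto
          also have "\<dots> \<le> (card A - p + (card B - q) - 1 + (card C - r) - 1) choose 2"
            using pqr by (intro choose_two_add_le) auto
          also have "card A - p + (card B - q) - 1 + (card C - r) - 1 = card V - l"
            using pqr cV l2 by linarith
          finally show ?thesis .
        qed
        moreover have "finite ?S" using S(1) T(1) U(1) by simp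
        ultimately show ?thesis by (intro exI[of _ ?S] conjI)
      qed
    qed
  qed
qed

section \<open>From some \<open>l\<close> colors to the \<open>l\<close> largest color
  classes\<close>

lemma sum_le_sum_initial:
  fixes e :: "nat \<Rightarrow> int"
  assumes dec: "\<And>i. 1 \<le> i \<Longrightarrow> i < k \<Longrightarrow> e i \<ge> e (i + 1)"
    and nonneg: "\<And>i. i \<in> {1..k} \<Longrightarrow> e i \<ge> 0"
    and S: "S \<subseteq> {1..k}" "card S \<le> l" and l: "l \<in> {1..k}"
  shows "sum e S \<le> sum e {1..l}"
proof -
  have mono: "e j \<le> e i" if "i \<le> j" "1 \<le> i" "j \<le> k" for i j
    using that(1,3)
  proof (induction j rule: dec_induct)
    case (step j)
    then show ?case using dec[of j] that(2) by simp
  qed simp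
  have fin: "finite S" using S finite_subset by blast
  have "card (S - {1..l}) + card (S \<inter> {1..l}) = card S"
    using fin by (metis add.commute card_Int_Diff)
  moreover have "card ({1..l} - S) + card (S \<inter> {1..l}) = l"
    by (metis Int_commute add.commute card_Int_Diff card_atLeastAtMost diff_Suc_1 finite_atLeastAtMost)
  ultimately have c: "card (S - {1..l}) \<le> card ({1..l} - S)" using S(2) by linarith
  \<comment> \<open>Exchange with threshold \<open>e l\<close>: indices of \<open>S\<close> beyond
    \<open>l\<close> contribute at most \<open>e l\<close> each, and indices up to \<open>l\<close>
    missing from \<open>S\<close> at least \<open>e l\<close> each. Since there may be strictly more
    of the latter, the threshold has to be nonnegative.\<close>
  have el: "e l \<ge> 0" using nonneg l by blast
  have "sum e (S - {1..l}) \<le> of_nat (card (S - {1..l})) * e l"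
    by (rule sum_bounded_above) (use S l mono in auto)
  also have "\<dots> \<le> of_nat (card ({1..l} - S)) * e l"
    using c el by (intro mult_right_mono) auto
  also have "\<dots> \<le> sum e ({1..l} - S)"
    by (rule sum_bounded_below) (use l mono in auto)
  finally have "sum e (S - {1..l}) \<le> sum e ({1..l} - S)" .
  moreover have "sum e S = sum e (S \<inter> {1..l}) + sum e (S - {1..l})"
    using fin by (rule sum.Int_Diff)
  moreover have "sum e {1..l} = sum e (S \<inter> {1..l}) + sum e ({1..l} - S)"
    using sum.Int_Diff[of "{1..l}" e S] by (simp add: Int_commute)
  ultimately show ?thesis by linarith
qed

text \<open>Each vertex deleted from a complete graph on \<open>j\<close> vertices removes
  \<open>j - 1\<close> edges; the sum records \<open>l\<close> deletions starting from
  \<open>n\<close> vertices.\<close>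

lemma sum_falling_eq:
  "l \<le> n \<Longrightarrow> (\<Sum>i=1..l. int n - int i) + int ((n - l) choose 2) = int (n choose 2)"
proof (induction l)
  case (Suc l)
  then have "n - l = Suc (n - Suc l)" by simp
  then have "(n - l) choose 2 = (n - Suc l) + ((n - Suc l) choose 2)" by (simp add: numeral_2_eq_2)
  then show ?case using Suc by (simp add: of_nat_diff)
qed simp

text \<open>Covers \<open>l > n\<close> as well: summands with \<open>i \<ge> n\<close> are not
  positive, so the integer sum does not grow beyond its value at \<open>n\<close>.\<close>

lemma sum_falling_le: "(\<Sum>i=1..l. int n - int i) \<le> int (n choose 2)"
proof (cases "l \<le> n")
  case True
  then show ?thesis using sum_falling_eq[of l n] by linarith
next
  case False
  then have "n \<le> l" by simp
  then show ?thesis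
  proof (induction l rule: dec_induct)
    case base
    show ?case using sum_falling_eq[of n n] by simp
  qed simp
qed

theorem corollary2:
  fixes n k :: nat and e :: "nat \<Rightarrow> int"
  assumes "n \<ge> 1" and "k \<ge> 1"
    and "\<And>i. 1 \<le> i \<Longrightarrow> i < k \<Longrightarrow> e i \<ge> e (i + 1)"
    and "(\<Sum>i=1..k. e i) = int (n choose 2)"
    and "\<exists>c. gallai_coloring {1..n} k c \<and>
           (\<forall>i\<in>{1..k}. int (card {E \<in> nsets {1..n} 2. c E = i}) = e i)"
  shows "\<forall>l\<in>{1..k}. (\<Sum>i=1..l. e i) \<ge> (\<Sum>i=1..l. int n - int i)"
proof
  fix l assume l: "l \<in> {1..k}"
  obtain c where gal: "gallai_coloring {1..n} k c"
    and e: "\<And>i. i \<in> {1..k} \<Longrightarrow> e i = int (card {E \<in> nsets {1..n} 2. c E = i})"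
    using assms(5) by metis
  have nonneg: "e i \<ge> 0" if "i \<in> {1..k}" for i using e[OF that] by simp
  have free: "rainbow_free c {1..n}" and range: "c \<in> nsets {1..n} 2 \<rightarrow> {1..k}"
    using gal unfolding gallai_coloring_def rainbow_free_def by auto
  \<comment> \<open>The number of colors \<open>k\<close>, and with it \<open>l\<close>, may reach
    or exceed \<open>n\<close>, whereas \<open>gallai_few_uncovered\<close> asks for fewer colors
    than vertices.\<close>
  define m where "m = min l (n - 1)"
  have "m < n" using assms(1) unfolding m_def by simp
  obtain S where S: "finite S" "card S \<le> m" "card (uncovered c {1..n} S) \<le> (n - m) choose 2"
    using gallai_few_uncovered[OF finite_atLeastAtMost free, of m] \<open>m < n\<close> by auto
  \<comment> \<open>\<open>S\<close> may contain numbers that are not colors; discarding them loses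
    no edges, as every edge has a color in \<open>{1..k}\<close>.\<close>
  let ?T = "S \<inter> {1..k}"
  let ?N = "\<lambda>i. {E \<in> nsets {1..n} 2. c E = i}"
  have "sum e ?T \<le> sum e {1..l}"
  proof (rule sum_le_sum_initial[where k = k])
    show "e (i + 1) \<le> e i" if "1 \<le> i" "i < k" for i using assms(3) that .
    show "e i \<ge> 0" if "i \<in> {1..k}" for i using nonneg that .
    show "l \<in> {1..k}" by (rule l)
    show "card ?T \<le> l"
      using card_mono[OF S(1), of ?T] S(2) unfolding m_def by auto
  qed auto
  moreover have "sum e ?T + int (card (uncovered c {1..n} S)) = int (n choose 2)"
  proof -
    have "sum e ?T = int (\<Sum>i\<in>?T. card (?N i))" using e by simp
    also have "(\<Sum>i\<in>?T. card (?N i)) = card (\<Union>i\<in>?T. ?N i)"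
      by (rule card_UN_disjoint[symmetric]) (auto simp: finite_imp_finite_nsets S(1))
    finally have 1: "sum e ?T = int (card (\<Union>i\<in>?T. ?N i))" .
    have "(\<Union>i\<in>?T. ?N i) \<union> uncovered c {1..n} S = nsets {1..n} 2"
      using range by (auto simp: uncovered_def)
    moreover have "card ((\<Union>i\<in>?T. ?N i) \<union> uncovered c {1..n} S) =
        card (\<Union>i\<in>?T. ?N i) + card (uncovered c {1..n} S)"
      by (rule card_Un_disjoint) (auto simp: uncovered_def finite_imp_finite_nsets S(1))
    ultimately show ?thesis using 1 by simp
  qed
  ultimately have *: "sum e {1..l} \<ge> int (n choose 2) - int ((n - m) choose 2)" using S(3) by linarith
  show "(\<Sum>i=1..l. e i) \<ge> (\<Sum>i=1..l. int n - int i)"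
  proof (cases "l \<le> n - 1")
    case True
    then have "m = l" "l \<le> n" unfolding m_def by auto
    then show ?thesis using * sum_falling_eq[of l n] by simp
  next
    case False
    \<comment> \<open>Here \<open>m = n - 1\<close>, so the bound on missed edges is
      \<open>1 choose 2\<close> and every edge is covered.\<close>
    then have none: "(n - m) choose 2 = 0" using assms(1) unfolding m_def by simp
    show ?thesis using *[unfolded none] sum_falling_le[of n l] by linarith
  qed
qed

end
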